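(* Let $n\ge1$ and $w\in S_n$. Let $\mathfrak{G}^{\beta-1}_w(q,q-1)$ be obtained from the double $\beta$-Grothendieck polynomial $\mathfrak{G}^{\beta}_w(\mathbf{x},\mathbf{y})$ by replacing $\beta$ with $\beta-1$, setting all $x_i=q$, and setting all $y_j=q-1$. Then $$\mathfrak{G}^{\beta-1}_w(q,q-1)=h(PD(w),\beta),$$ where $h(PD(w),\beta)$ is the $h$-polynomial of the pipe dream complex $PD(w)$. In particular, $\mathfrak{G}^{\beta-1}_w(q,q-1)\in\mathbb{Z}_{\ge0}[\beta]$.
   Context: Let $s_k=(k\ k+1)$ denote the simple transpositions of $S_n$ and $l$ the Coxeter length. Let $D_n=\{(i,j): i,j\ge 1,\ i+j\le n\}$, a staircase of $N=n(n-1)/2$ boxes. Order the boxes by reading the rows from top to bottom, each row from right to left, and assign to box $(i,j)$ the letter $s_{i+j-1}$. This gives the triangular word $Q=(s_{n-1},\dots,s_1,\ s_{n-1},\dots,s_2,\ \dots,\ s_{n-1})$. For $S\subseteq D_n$, its Demazure product $\delta(S)$ is computed by starting with $u=\mathrm{id}$ and processing the boxes of $S$ in order: for a letter $s_k$, replace $u$ by $us_k$ if $l(us_k)>l(u)$, and otherwise keep $u$ (equivalently, in the pipe picture, crossings of pipes that have already crossed are ignored). A pipe dream for $w$ is a set $P\subseteq D_n$ of crosses with $\delta(P)=w$. The set of all pipe dreams for $w$, reduced or nonreduced, is denoted $\mathrm{Pipes}(w)$. The pipe dream complex $PD(w)$ is the simplicial complex on vertex set $D_n$ whose faces are the sets $F\subseteq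 D_n$ such that the subword of $Q$ in the positions $D_n\setminus F$ contains a reduced word for $w$. It has dimension $N-l(w)-1$. The interior faces are exactly $F(P)=D_n\setminus P$ for $P\in\mathrm{Pipes}(w)$, and $\mathrm{codim}_{PD(w)}F(P)=\dim PD(w)-(|F(P)|-1)$. The double $\beta$-Grothendieck polynomial is $\mathfrak{G}^{\beta}_w(\mathbf{x},\mathbf{y})=\sum_{P\in\mathrm{Pipes}(w)}\beta^{\mathrm{codim}_{PD(w)}F(P)}\prod_{(i,j)\in P}(x_i-y_j)$. For a $(d-1)$-dimensional simplicial complex $\mathcal{C}$, let $f_i$ be its number of $i$-dimensional faces, with $f_{-1}=1$. Define $h_0,\dots,h_d$ by $\sum_{i=0}^d f_{i-1}(x-1)^{d-i}=\sum_{i=0}^d h_ix^{d-i}$. The $h$-polynomial is $h(\mathcal{C},x)=\sum_{i=0}^d h_ix^i$. *)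

theory Defs
  imports
    "HOL-Library.Poly_Mapping"
    "HOL-Library.Sublist"
    "HOL-Computational_Algebra.Polynomial"
    "HOL-Combinatorics.Permutations"
begin

section \<open>Words and length in the symmetric group\<close>

text \<open>
  The group \<open>S\<^sub>n\<close> consists of the functions \<open>w :: nat \<Rightarrow> nat\<close> with \<open>w permutes {1..n}\<close>, with
  product \<open>u v = u \<circ> v\<close>.
\<close>

definition simple_transp :: "nat \<Rightarrow> nat \<Rightarrow> nat"
  where "simple_transp k = transpose k (k + 1)"

definition word_product :: "nat list \<Rightarrow> nat \<Rightarrow> nat"
  where "word_product ks = foldl (\<lambda>u k. u \<circ> simple_transp k) id ks"

text \<open>Meaningful for elements of \<open>S\<^sub>n\<close> only: otherwise no such word exists.\<close>

definition coxeter_length :: "nat \<Rightarrow> (nat \<Rightarrow> nat) \<Rightarrow> nat"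
  where "coxeter_length n w =
    (LEAST m. \<exists>ks. set ks \<subseteq> {1..<n} \<and> word_product ks = w \<and> length ks = m)"

definition reduced_word :: "nat \<Rightarrow> (nat \<Rightarrow> nat) \<Rightarrow> nat list \<Rightarrow> bool"
  where "reduced_word n w ks \<longleftrightarrow>
    set ks \<subseteq> {1..<n} \<and> word_product ks = w \<and> length ks = coxeter_length n w"

section \<open>Pipe dreams\<close>

definition staircase :: "nat \<Rightarrow> (nat \<times> nat) set"
  where "staircase n = {(i, j). 1 \<le> i \<and> 1 \<le> j \<and> i + j \<le> n}"

text \<open>Rows from top to bottom, each row from right to left.\<close>

definition boxes :: "nat \<Rightarrow> (nat \<times> nat) list"
  where "boxes n = concat (map (\<lambda>i. map (\<lambda>j. (i, j)) (rev [1..<Suc (n - i)])) [1..<n])"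

lemma set_boxes: "set (boxes n) = staircase n"
  by (force simp: boxes_def staircase_def)

text \<open>The subword of the triangular word \<open>Q\<close> in the positions belonging to \<open>S\<close>.\<close>

definition subword :: "nat \<Rightarrow> (nat \<times> nat) set \<Rightarrow> nat list"
  where "subword n S = map (\<lambda>(i, j). i + j - 1) (filter (\<lambda>b. b \<in> S) (boxes n))"

definition demazure_product :: "nat \<Rightarrow> (nat \<times> nat) set \<Rightarrow> nat \<Rightarrow> nat"
  where "demazure_product n S =
    foldl (\<lambda>u k. if coxeter_length n (u \<circ> simple_transp k) > coxeter_length n u
                 then u \<circ> simple_transp k else u)
      id (subword n S)"

definition Pipes :: "nat \<Rightarrow> (nat \<Rightarrow> nat) \<Rightarrow> (nat \<times> nat) set set"
  where "Pipes n w = {P. P \<subseteq> staircase n \<and> demazure_product n P = w}"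

definition PD :: "nat \<Rightarrow> (nat \<Rightarrow> nat) \<Rightarrow> (nat \<times> nat) set set"
  where "PD n w = {F. F \<subseteq> staircase n \<and>
    (\<exists>ks. subseq ks (subword n (staircase n - F)) \<and> reduced_word n w ks)}"

section \<open>The \<open>h\<close>-polynomial of a simplicial complex\<close>

text \<open>
  A finite simplicial complex is represented by the set \<open>\<Delta>\<close> of its faces, including the empty
  face, which has dimension \<open>-1\<close>.
\<close>

definition face_dim :: "'a set \<Rightarrow> int"
  where "face_dim F = int (card F) - 1"

definition complex_dim :: "'a set set \<Rightarrow> int"
  where "complex_dim \<Delta> = Max (face_dim ` \<Delta>)"

text \<open>The codimension is nonnegative whenever \<open>F\<close> is a face of \<open>\<Delta>\<close>.\<close>

definition codim :: "'a set set \<Rightarrow> 'a set \<Rightarrow> nat"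
  where "codim \<Delta> F = nat (complex_dim \<Delta> - face_dim F)"

definition f_number :: "'a set set \<Rightarrow> int \<Rightarrow> nat"
  where "f_number \<Delta> i = card {F \<in> \<Delta>. face_dim F = i}"

text \<open>
  With \<open>d = complex_dim \<Delta> + 1\<close>, the numbers \<open>h\<^sub>0, \<dots>, h\<^sub>d\<close> are determined by
  \<open>(\<Sum>i\<le>d. f\<^sub>i\<^sub>-\<^sub>1 (x - 1)\<^sup>d\<^sup>-\<^sup>i) = (\<Sum>i\<le>d. h\<^sub>i x\<^sup>d\<^sup>-\<^sup>i)\<close>: the number \<open>h\<^sub>i\<close> is the
  coefficient of \<open>x\<^sup>d\<^sup>-\<^sup>i\<close> on the left.
\<close>

definition h_number :: "'a set set \<Rightarrow> nat \<Rightarrow> int"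
  where "h_number \<Delta> i =
    (let d = nat (complex_dim \<Delta> + 1)
     in coeff (\<Sum>k\<le>d. smult (int (f_number \<Delta> (int k - 1))) ([:-1, 1:] ^ (d - k))) (d - i))"

definition h_polynomial :: "'a set set \<Rightarrow> int poly"
  where "h_polynomial \<Delta> = (\<Sum>i\<le>nat (complex_dim \<Delta> + 1). monom (h_number \<Delta> i) i)"

section \<open>Double Grothendieck polynomials\<close>

datatype gvar = Beta | X nat | Y nat

text \<open>
  Polynomials with integer coefficients in variables from \<open>'v\<close>: finitely supported functions from
  monomials (exponent vectors) to coefficients, multiplied by convolution.
\<close>

type_synonym 'v mpoly_int = "('v \<Rightarrow>\<^sub>0 nat) \<Rightarrow>\<^sub>0 int"

definition Var :: "'v \<Rightarrow> 'v mpoly_int"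
  where "Var v = Poly_Mapping.single (Poly_Mapping.single v 1) 1"

definition substitute :: "('v \<Rightarrow> 'r::comm_ring_1) \<Rightarrow> 'v mpoly_int \<Rightarrow> 'r"
  where "substitute \<phi> p =
    (\<Sum>m\<in>Poly_Mapping.keys p. of_int (Poly_Mapping.lookup p m) *
      (\<Prod>v\<in>Poly_Mapping.keys m. \<phi> v ^ Poly_Mapping.lookup m v))"

definition double_grothendieck :: "nat \<Rightarrow> (nat \<Rightarrow> nat) \<Rightarrow> gvar mpoly_int"
  where "double_grothendieck n w =
    (\<Sum>P\<in>Pipes n w. Var Beta ^ codim (PD n w) (staircase n - P) *
      (\<Prod>(i, j)\<in>P. Var (X i) - Var (Y j)))"

text \<open>
  The type \<open>int poly poly\<close> is the ring \<open>\<int>[q][\<beta>]\<close>: \<open>\<beta>\<close> is the outer variable and \<open>q\<close> the variable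
  of the coefficients.  The map \<open>map_poly of_int\<close> embeds \<open>\<int>[\<beta>]\<close> into it.
\<close>

definition beta_var :: "int poly poly"
  where "beta_var = [:0, 1:]"

definition q_var :: "int poly poly"
  where "q_var = [:[:0, 1:]:]"

definition specialized_grothendieck :: "nat \<Rightarrow> (nat \<Rightarrow> nat) \<Rightarrow> int poly poly"
  where "specialized_grothendieck n w =
    substitute (\<lambda>v. case v of Beta \<Rightarrow> beta_var - 1 | X i \<Rightarrow> q_var | Y j \<Rightarrow> q_var - 1) (double_grothendieck n w)"

end

(*
  With x_i - y_j = 1 and codim F(P) = |P| - l(w), the left side is the sum of (\<beta> - 1)^(|P| - l(w))
  over the P with Demazure product w.  The h-polynomial is the sum, over the sets S whose subword
  contains a reduced word for w, of \<beta>^(N - |S|) (1 - \<beta>)^(|S| - l(w)).  Both sums make sense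
  for every word Q, and deleting the last letter k of Q = Q' k gives the same recursion for both:
    T(Q' k, w) = \<beta> T(Q', w) + T(Q', w s_k)   if l(w s_k) < l(w),
    T(Q' k, w) = T(Q', w)                     otherwise.
  This is the vertex decomposition of a subword complex; nonnegativity is immediate from it.
*)

theory Submission
  imports Defs
begin

section \<open>Length and descents in the symmetric group\<close>

lemma word_product_Nil [simp]: "word_product [] = id"
  by (simp add: word_product_def)

lemma word_product_snoc [simp]: "word_product (ks @ [k]) = word_product ks \<circ> simple_transp k"
  by (simp add: word_product_def)

lemma word_product_append: "word_product (ks @ ls) = word_product ks \<circ> word_product ls"
  by (induction ls rule: rev_induct) (simp_all flip: append_assoc add: comp_assoc)

lemma simple_transp_involutory [simp]: "simple_transp k (simple_transp k a) = a"
  by (simp add: simple_transp_def)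

lemma comp_simple_transp_cancel [simp]: "w \<circ> simple_transp k \<circ> simple_transp k = w"
  by (simp add: fun_eq_iff)

lemma simple_transp_eq_comp_iff: "u \<circ> simple_transp k = w \<longleftrightarrow> u = w \<circ> simple_transp k"
  by auto

lemma simple_transp_permutes: "k \<in> {m..<n} \<Longrightarrow> simple_transp k permutes {m..n}"
  unfolding simple_transp_def by (rule permutes_swap_id) auto

lemma comp_simple_transp_permutes:
  "w permutes {m..n} \<Longrightarrow> k \<in> {m..<n} \<Longrightarrow> w \<circ> simple_transp k permutes {m..n}"
  by (intro permutes_compose simple_transp_permutes)

lemma word_product_permutes: "set ks \<subseteq> {m..<n} \<Longrightarrow> word_product ks permutes {m..n}"
  by (induction ks rule: rev_induct) (auto intro: permutes_id comp_simple_transp_permutes)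

text \<open>Stands for l(w s_k) < l(w), which \<open>coxeter_length_descent\<close> and
  \<open>coxeter_length_ascent\<close> justify for w in S_n and 1 <= k < n. Comparing two values is
  easier than comparing two minima over words.\<close>

abbreviation descent :: "(nat \<Rightarrow> nat) \<Rightarrow> nat \<Rightarrow> bool"
  where "descent w k \<equiv> w (k + 1) < w k"

lemma descent_comp_simple_transp:
  assumes "w permutes A"
  shows "descent (w \<circ> simple_transp k) k \<longleftrightarrow> \<not> descent w k"
proof -
  have "w k \<noteq> w (k + 1)"
    using permutes_inj[OF assms] by (metis injD n_not_Suc_n Suc_eq_plus1)
  then show ?thesis by (auto simp: simple_transp_def)
qed

section \<open>The exchange property of words\<close>

text \<open>
  The letter to delete is the one whose factor reverses the images of \<open>a\<close> and \<open>b\<close> when the word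
  is applied to them from the right.
\<close>

lemma word_exchange:
  assumes "a < b" "word_product ks b < word_product ks a"
  shows "\<exists>ls. subseq ls ks \<and> length ks = Suc (length ls) \<and>
    word_product ls = word_product ks \<circ> transpose a b"
  using assms
proof (induction ks arbitrary: a b rule: rev_induct)
  case Nil
  then show ?case by simp
next
  case (snoc j ks)
  show ?case
  \<comment> \<open>The letter j preserves the order of a < b unless it swaps exactly this pair. So
    either j is the letter to delete, or the reversal already happens in the shorter word.\<close>
  proof (cases "a = j \<and> b = Suc j")
    case True
    then have "transpose a b = simple_transp j" by (simp add: simple_transp_def)
    then show ?thesis by (intro exI[of _ ks]) (simp add: subseq_rev_drop_many comp_def)
  next
    case False
    let ?s = "simple_transp j"
    have "?s a < ?s b"
      using False snoc.prems(1) by (auto simp: simple_transp_def transpose_def)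
    moreover have "word_product ks (?s b) < word_product ks (?s a)"
      using snoc.prems(2) by simp
    ultimately obtain ls where ls: "subseq ls ks" "length ks = Suc (length ls)"
      "word_product ls = word_product ks \<circ> transpose (?s a) (?s b)"
      using snoc.IH by blast
    \<comment> \<open>Conjugation by s_j relabels the two points of a transposition, so putting the
      letter j back restores \<open>transpose a b\<close>.\<close>
    have "transpose (?s a) (?s b) \<circ> ?s = ?s \<circ> transpose a b"
      by (rule ext) (auto simp: simple_transp_def transpose_def)
    then have "word_product (ls @ [j]) = word_product (ks @ [j]) \<circ> transpose a b"
      by (simp add: ls(3) comp_assoc)
    then show ?thesis using ls(1,2) by (intro exI[of _ "ls @ [j]"]) auto
  qed
qed

text \<open>The right exchange condition, for arbitrary words: take the adjacent points k and k + 1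
  above.\<close>

lemma word_exchange_descent:
  assumes "descent (word_product ks) k"
  obtains ls where "subseq ls ks" "length ks = Suc (length ls)"
    "word_product ls = word_product ks \<circ> simple_transp k"
  using word_exchange[of k "k + 1" ks] assms by (auto simp: simple_transp_def)

section \<open>Words for a given permutation inside the triangular word\<close>

lemma subseq_set: "subseq xs ys \<Longrightarrow> set xs \<subseteq> set ys"
  by (auto simp: subseq_conv_nths in_set_nthsD dest: in_set_nthsD)

lemma coxeter_length_le: "set ks \<subseteq> {1..<n} \<Longrightarrow> coxeter_length n (word_product ks) \<le> length ks"
  unfolding coxeter_length_def by (rule Least_le) blast

lemma coxeter_length_id [simp]: "coxeter_length n id = 0"
  using coxeter_length_le[of "[]" n] by simp

lemma word_product_rev_upt: "i \<le> a \<Longrightarrow> word_product (rev [i..<a]) i = a"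
proof (induction a rule: dec_induct)
  case base
  then show ?case by simp
next
  case (step a)
  then show ?case
    using word_product_append[of "[a]" "rev [i..<a]"] word_product_snoc[of "[]" a]
    by (simp add: simple_transp_def)
qed

text \<open>
  Peeling off \<open>w i = a\<close>: the word \<open>s\<^sub>a\<^sub>-\<^sub>1 \<dots> s\<^sub>i\<close> sends \<open>i\<close> to \<open>a\<close>, so that it remains to write a
  permutation of \<open>{i + 1..n}\<close> in the later rows.
\<close>

lemma subseq_triangular_word:
  assumes "w permutes {i..n}" "i \<le> n"
  shows "\<exists>ks. subseq ks (concat (map (\<lambda>i. rev [i..<n]) [i..<n])) \<and> word_product ks = w"
  using assms(2,1)
proof (induction i arbitrary: w rule: inc_induct)
  case base
  then have "w = id" by simp
  then show ?case by (intro exI[of _ "[]"]) simp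
next
  case (step i)
  define a where "a = w i"
  have a: "i \<le> a" "a \<le> n"
    using permutes_in_image[OF step.prems, of i] step.hyps by (auto simp: a_def)
  define c where "c = word_product (rev [i..<a])"
  have c: "c permutes {i..n}"
    unfolding c_def using a by (intro word_product_permutes) auto
  have ci: "c i = a"
    unfolding c_def using a(1) by (rule word_product_rev_upt)
  define v where "v = inv c \<circ> w"
  have v: "v permutes {i..n}"
    unfolding v_def by (intro permutes_compose step.prems permutes_inv c)
  have vi: "v i = i"
    using permutes_inverses(2)[OF c, of i] by (simp add: v_def ci flip: a_def)
  have "v permutes {Suc i..n}"
    using v by (rule permutes_superset) (use vi in \<open>auto simp: not_less_eq_eq le_antisym\<close>)
  then obtain ks where ks: "subseq ks (concat (map (\<lambda>i. rev [i..<n]) [Suc i..<n]))"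
    "word_product ks = v"
    using step.IH by blast
  \<comment> \<open>The word that sends i to a is a final segment of row i.\<close>
  have "rev [i..<n] = rev [a..<n] @ rev [i..<a]"
    using a upt_add_eq_append[of i a "n - a"] by simp
  then have "subseq (rev [i..<a]) (rev [i..<n])" by (simp add: subseq_drop_many)
  then have "subseq (rev [i..<a] @ ks)
      (rev [i..<n] @ concat (map (\<lambda>i. rev [i..<n]) [Suc i..<n]))"
    using ks(1) by (rule list_emb_append_mono)
  moreover have "[i..<n] = i # [Suc i..<n]" using step.hyps by (simp add: upt_conv_Cons)
  ultimately have "subseq (rev [i..<a] @ ks) (concat (map (\<lambda>i. rev [i..<n]) [i..<n]))"
    by (simp only: list.map concat.simps)
  moreover have "word_product (rev [i..<a] @ ks) = w"
    using permutes_inv_o(1)[OF c]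
    by (simp add: word_product_append ks(2) v_def flip: c_def comp_assoc)
  ultimately show ?case by blast
qed

text \<open>The minimum in \<open>coxeter_length\<close> is attained, because the triangular word
  contains some word for w. For n = 0 there is only the identity.\<close>

lemma reduced_word_exists:
  assumes "w permutes {1..n}"
  obtains ks where "reduced_word n w ks"
proof (cases "1 \<le> n")
  case True
  then obtain ks where ks: "subseq ks (concat (map (\<lambda>i. rev [i..<n]) [1..<n]))"
      "word_product ks = w"
    using subseq_triangular_word[OF assms] by blast
  have "set ks \<subseteq> {1..<n}" using subseq_set[OF ks(1)] by fastforce
  then have "\<exists>ks. set ks \<subseteq> {1..<n} \<and> word_product ks = w \<and> length ks = coxeter_length n w"
    unfolding coxeter_length_def
    using LeastI_ex[of "\<lambda>m. \<exists>ks. set ks \<subseteq> {1..<n} \<and> word_product ks = w \<and> length ks = m"] ks(2)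
    by blast
  then show ?thesis using that unfolding reduced_word_def by blast
next
  case False
  then have "w = id" using assms by (simp add: not_less_eq_eq)
  then show ?thesis using that[of "[]"] by (simp add: reduced_word_def)
qed

text \<open>Exchange in a reduced word for w leaves a word for w s_k that is one letter shorter;
  conversely, a reduced word for w s_k followed by k is a word for w.\<close>

lemma coxeter_length_descent:
  assumes w: "w permutes {1..n}" and k: "k \<in> {1..<n}" and d: "descent w k"
  shows "coxeter_length n w = Suc (coxeter_length n (w \<circ> simple_transp k))"
proof (rule antisym)
  obtain ks where ks: "reduced_word n w ks" by (rule reduced_word_exists[OF w])
  then obtain ls where ls: "subseq ls ks" "length ks = Suc (length ls)"
    "word_product ls = w \<circ> simple_transp k"
    using word_exchange_descent[of ks k] d by (auto simp: reduced_word_def)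
  have "set ls \<subseteq> {1..<n}"
    using ks subseq_set[OF ls(1)] unfolding reduced_word_def by blast
  from coxeter_length_le[OF this]
  show "Suc (coxeter_length n (w \<circ> simple_transp k)) \<le> coxeter_length n w"
    using ls ks by (simp add: reduced_word_def)
next
  obtain ls where "reduced_word n (w \<circ> simple_transp k) ls"
    by (rule reduced_word_exists[OF comp_simple_transp_permutes[OF w k]])
  then show "coxeter_length n w \<le> Suc (coxeter_length n (w \<circ> simple_transp k))"
    using coxeter_length_le[of "ls @ [k]" n] k by (simp add: reduced_word_def)
qed

lemma coxeter_length_ascent:
  assumes "w permutes {1..n}" "k \<in> {1..<n}" "\<not> descent w k"
  shows "coxeter_length n (w \<circ> simple_transp k) = Suc (coxeter_length n w)"
  using coxeter_length_descent[OF comp_simple_transp_permutes[OF assms(1,2)] assms(2)]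
    descent_comp_simple_transp[OF assms(1)] assms(3) by simp

lemma coxeter_length_less_iff:
  assumes "w permutes {1..n}" "k \<in> {1..<n}"
  shows "coxeter_length n w < coxeter_length n (w \<circ> simple_transp k) \<longleftrightarrow> \<not> descent w k"
  using coxeter_length_descent[OF assms] coxeter_length_ascent[OF assms] by fastforce

section \<open>Demazure products and reduced subwords\<close>

text \<open>The face condition of \<open>PD\<close>, freed from the staircase so that a word can
  lose its last letter.\<close>

definition contains_reduced :: "nat \<Rightarrow> (nat \<Rightarrow> nat) \<Rightarrow> nat list \<Rightarrow> bool"
  where "contains_reduced n w us \<longleftrightarrow> (\<exists>ks. subseq ks us \<and> reduced_word n w ks)"

lemma contains_reducedI: "reduced_word n w ks \<Longrightarrow> subseq ks us \<Longrightarrow> contains_reduced n w us"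
  by (auto simp: contains_reduced_def)

lemma contains_reduced_Nil: "contains_reduced n w [] \<longleftrightarrow> w = id"
  by (auto simp: contains_reduced_def reduced_word_def dest: list_emb_Nil2 intro: exI[of _ "[]"])

lemma contains_reduced_length: "contains_reduced n w us \<Longrightarrow> coxeter_length n w \<le> length us"
  by (auto simp: contains_reduced_def reduced_word_def dest: list_emb_length)

text \<open>The deletion property. Reading \<open>ks\<close> from the left, keep a reduced word for
  the part read: a letter that lengthens the product is appended, one that shortens it cancels an
  earlier letter by exchange. The kept word always stays a subword of \<open>us\<close>.\<close>

lemma contains_reduced_word_product:
  assumes "subseq ks us" "set us \<subseteq> {1..<n}"
  shows "contains_reduced n (word_product ks) us"
  using assms
proof (induction us arbitrary: ks rule: rev_induct)
  case Nil
  then show ?case by (auto simp: contains_reduced_Nil dest: list_emb_Nil2)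
next
  case (snoc k us)
  from snoc.prems(1) obtain ls ms where ks: "ks = ls @ ms" and ls: "subseq ls us"
    and ms: "subseq ms [k]"
    by (rule subseq_appendE)
  obtain rs where rs: "subseq rs us" "reduced_word n (word_product ls) rs"
    using snoc.IH[OF ls] snoc.prems(2) by (auto simp: contains_reduced_def)
  have k: "k \<in> {1..<n}" and perm: "word_product ls permutes {1..n}"
    using snoc.prems(2) subseq_set[OF ls] by (auto intro: word_product_permutes)
  have ms': "ms = [] \<or> ms = [k]"
    using ms by (cases ms) (auto split: if_splits dest: list_emb_Nil2)
  show ?case
  proof (cases "ms = []")
    case True
    then show ?thesis using rs by (auto simp: ks contains_reduced_def intro: subseq_rev_drop_many)
  next
    case False
    with ms' ks have ks: "ks = ls @ [k]" by simp
    show ?thesis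
    proof (cases "descent (word_product ls) k")
      case True
      then obtain qs where qs: "subseq qs rs" "length rs = Suc (length qs)"
        "word_product qs = word_product ls \<circ> simple_transp k"
        using word_exchange_descent[of rs k] rs by (auto simp: reduced_word_def)
      have "set qs \<subseteq> {1..<n}"
        using rs(2) subseq_set[OF qs(1)] unfolding reduced_word_def by blast
      then have "reduced_word n (word_product ks) qs"
        using qs rs(2) coxeter_length_descent[OF perm k True]
        by (simp add: reduced_word_def ks)
      moreover have "subseq qs (us @ [k])"
        using qs(1) rs(1) by (meson subseq_order.trans subseq_rev_drop_many)
      ultimately show ?thesis by (auto simp: contains_reduced_def)
    next
      case False
      then have "reduced_word n (word_product ks) (rs @ [k])"
        using rs(2) k coxeter_length_ascent[OF perm k False]
        by (simp add: reduced_word_def ks)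
      then show ?thesis using rs(1) by (intro contains_reducedI) auto
    qed
  qed
qed

text \<open>At a descent, a subword for w s_k extends by the letter k, and a subword for w yields
  one for w s_k by dropping a final k or by exchange. Otherwise no reduced word for w ends in k, so
  the last letter is useless.\<close>

lemma contains_reduced_snoc:
  assumes w: "w permutes {1..n}" and us: "set us \<subseteq> {1..<n}" and k: "k \<in> {1..<n}"
  shows "contains_reduced n w (us @ [k]) \<longleftrightarrow>
    contains_reduced n (if descent w k then w \<circ> simple_transp k else w) us"
    (is "?L \<longleftrightarrow> ?R")
proof
  assume ?L
  then obtain ks where ks: "subseq ks (us @ [k])" "reduced_word n w ks"
    by (auto simp: contains_reduced_def)
  from ks(1) obtain ls ms where eq: "ks = ls @ ms" and ls: "subseq ls us" and "subseq ms [k]"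
    by (rule subseq_appendE)
  then have ms: "ms = [] \<or> ms = [k]"
    by (cases ms) (auto split: if_splits dest: list_emb_Nil2)
  have prod: "word_product ks = w" using ks(2) by (simp add: reduced_word_def)
  have lset: "set ls \<subseteq> {1..<n}" using us subseq_set[OF ls] by blast
  show ?R
  proof (cases "descent w k")
    case True
    \<comment> \<open>Any word will do here; \<open>contains_reduced_word_product\<close> then finds
      a reduced one inside \<open>us\<close>.\<close>
    have "\<exists>qs. subseq qs us \<and> word_product qs = w \<circ> simple_transp k"
    proof (cases "ms = []")
      case True
      then have "word_product ls = w" using prod eq by simp
      then obtain qs where "subseq qs ls" "word_product qs = w \<circ> simple_transp k"
        using word_exchange_descent[of ls k] \<open>descent w k\<close> by auto
      then show ?thesis using ls by (meson subseq_order.trans)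
    next
      case False
      then have "w = word_product ls \<circ> simple_transp k" using ms prod eq by auto
      then show ?thesis using ls by auto
    qed
    then show ?thesis using True contains_reduced_word_product us by fastforce
  next
    case False
    \<comment> \<open>A final k would leave a word of length l(w) - 1 for w s_k, whose length is
      l(w) + 1.\<close>
    have "ms = []"
    proof (rule ccontr)
      assume "ms \<noteq> []"
      then have "ks = ls @ [k]" using ms eq by auto
      then have "word_product ls = w \<circ> simple_transp k" "coxeter_length n w = Suc (length ls)"
        using ks(2) by (auto simp: reduced_word_def)
      then show False
        using coxeter_length_le[OF lset] coxeter_length_ascent[OF w k False] by simp
    qed
    then show ?thesis using ks(2) eq ls False by (auto simp: contains_reduced_def)
  qed
next
  assume ?R
  then obtain ks where ks: "subseq ks us"
    "reduced_word n (if descent w k then w \<circ> simple_transp k else w) ks"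
    by (auto simp: contains_reduced_def)
  show ?L
  proof (cases "descent w k")
    case True
    then have "reduced_word n w (ks @ [k])"
      using ks(2) k coxeter_length_descent[OF w k True] by (simp add: reduced_word_def)
    then show ?thesis using ks(1) by (intro contains_reducedI) auto
  next
    case False
    then show ?thesis using ks by (auto simp: contains_reduced_def intro: subseq_rev_drop_many)
  qed
qed

text \<open>Defined on words rather than sets of boxes, for induction on the last letter.\<close>

definition word_demazure :: "nat \<Rightarrow> nat list \<Rightarrow> nat \<Rightarrow> nat"
  where "word_demazure n us =
    foldl (\<lambda>u k. if coxeter_length n (u \<circ> simple_transp k) > coxeter_length n u
                 then u \<circ> simple_transp k else u) id us"

lemma word_demazure_Nil [simp]: "word_demazure n [] = id"
  by (simp add: word_demazure_def)

lemma word_demazure_permutes: "set us \<subseteq> {1..<n} \<Longrightarrow> word_demazure n us permutes {1..n}"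
  by (induction us rule: rev_induct)
    (auto simp: word_demazure_def intro: permutes_id comp_simple_transp_permutes)

lemma word_demazure_snoc:
  assumes "set us \<subseteq> {1..<n}" "k \<in> {1..<n}"
  shows "word_demazure n (us @ [k]) =
    (if descent (word_demazure n us) k then word_demazure n us
     else word_demazure n us \<circ> simple_transp k)"
  using coxeter_length_less_iff[OF word_demazure_permutes[OF assms(1)] assms(2)]
  by (simp add: word_demazure_def)

lemma word_demazure_length:
  assumes "set us \<subseteq> {1..<n}"
  shows "coxeter_length n (word_demazure n us) \<le> length us"
  using assms
proof (induction us rule: rev_induct)
  case Nil
  show ?case by (simp only: word_demazure_Nil coxeter_length_id list.size)
next
  case (snoc k us)
  then have us: "set us \<subseteq> {1..<n}" and k: "k \<in> {1..<n}" by auto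
  from snoc.IH[OF us] show ?case
    using coxeter_length_ascent[OF word_demazure_permutes[OF us] k]
    by (simp add: word_demazure_snoc[OF us k])
qed

text \<open>Once k is processed, the product has a descent at k. The last step either kept w or
  raised w s_k to w.\<close>

lemma word_demazure_snoc_eq_iff:
  assumes us: "set us \<subseteq> {1..<n}" and k: "k \<in> {1..<n}"
  shows "word_demazure n (us @ [k]) = w \<longleftrightarrow>
    descent w k \<and> (word_demazure n us = w \<or> word_demazure n us = w \<circ> simple_transp k)"
proof -
  have "descent (word_demazure n us \<circ> simple_transp k) k \<longleftrightarrow> \<not> descent (word_demazure n us) k"
    by (rule descent_comp_simple_transp[OF word_demazure_permutes[OF us]])
  then show ?thesis
    unfolding word_demazure_snoc[OF us k] by (auto simp: simple_transp_eq_comp_iff)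
qed

section \<open>The common recursion\<close>

text \<open>The list is the word reversed: its head is the last letter. Coefficients range over any
  commutative semiring, so that one recursion serves the integers, Z[q] and the natural
  numbers.\<close>

fun subword_poly :: "nat list \<Rightarrow> (nat \<Rightarrow> nat) \<Rightarrow> 'a::comm_semiring_1 poly"
  where
    "subword_poly [] w = (if w = id then 1 else 0)"
  | "subword_poly (k # ks) w =
      (if descent w k then pCons 0 (subword_poly ks w) + subword_poly ks (w \<circ> simple_transp k)
       else subword_poly ks w)"

text \<open>The recursion only adds and shifts, starting from 0 and 1, so every additive map that
  fixes 0 and 1 commutes with it. It is applied to \<open>of_int\<close> and
  \<open>of_nat\<close>.\<close>

lemma map_poly_subword_poly:
  assumes f: "f 0 = 0" "f 1 = 1" "\<And>a b. f (a + b) = f a + f b"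
  shows "map_poly f (subword_poly ks w) = subword_poly ks w"
proof (induction ks arbitrary: w)
  case Nil
  then show ?case using f by simp
next
  case (Cons k ks)
  have add: "map_poly f (p + q) = map_poly f p + map_poly f q" for p q
    using f by (intro poly_eqI) (simp add: coeff_map_poly)
  have pCons: "map_poly f (pCons 0 p) = pCons 0 (map_poly f p)" for p
    using f by (intro poly_eqI) (simp add: coeff_map_poly coeff_pCons split: nat.split)
  show ?case by (simp only: subword_poly.simps add pCons Cons.IH split: if_split) blast
qed

section \<open>Sums over subsets, split by membership of the last box\<close>

lemma sum_Pow_insert:
  assumes "finite B" "b \<notin> B"
  shows "(\<Sum>P\<in>Pow (insert b B). f P) = (\<Sum>P\<in>Pow B. f P + f (insert b P))"
proof -
  have "inj_on (insert b) (Pow B)"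
    using assms(2) by (auto simp: inj_on_def)
  moreover have "Pow B \<inter> insert b ` Pow B = {}"
    using assms(2) by auto
  ultimately show ?thesis
    using assms(1) by (simp add: Pow_insert sum.union_disjoint sum.reindex sum.distrib)
qed

lemma length_filter_subset:
  "distinct bs \<Longrightarrow> P \<subseteq> set bs \<Longrightarrow> length (filter (\<lambda>b. b \<in> P) bs) = card P"
  by (simp add: distinct_length_filter Int_absorb2)

lemma filter_insert_snoc:
  assumes "b \<notin> set bs" "P \<subseteq> set bs"
  shows "filter (\<lambda>x. x \<in> P) (bs @ [b]) = filter (\<lambda>x. x \<in> P) bs"
    and "filter (\<lambda>x. x \<in> insert b P) (bs @ [b]) = filter (\<lambda>x. x \<in> P) bs @ [b]"
  using assms by (auto intro!: filter_cong)

text \<open>Each P without the last box b is paired with \<open>insert b P\<close>. By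
  \<open>word_demazure_snoc_eq_iff\<close> the second set contributes only at a descent, and then
  when P has product w or w s_k.\<close>

lemma sum_demazure_eq_subword_poly:
  assumes "distinct bs" "c ` set bs \<subseteq> {1..<n}" "w permutes {1..n}"
  shows "(\<Sum>P\<in>Pow (set bs). if word_demazure n (map c (filter (\<lambda>b. b \<in> P) bs)) = w
      then ([:0, 1:] - 1) ^ (card P - coxeter_length n w) else 0) =
    (subword_poly (rev (map c bs)) w :: 'a::comm_ring_1 poly)"
  using assms
proof (induction bs arbitrary: w rule: rev_induct)
  case Nil
  then show ?case by auto
next
  case (snoc b bs)
  let ?l = "coxeter_length n"
  let ?X = "[:0, 1:] :: 'a poly"
  let ?s = "simple_transp (c b)"
  let ?dem = "\<lambda>P. word_demazure n (map c (filter (\<lambda>b. b \<in> P) bs))"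
  define f where "f w P = (if ?dem P = w then (?X - 1) ^ (card P - ?l w) else 0)" for w P
  define g where "g P = (if word_demazure n (map c (filter (\<lambda>x. x \<in> P) (bs @ [b]))) = w
      then (?X - 1) ^ (card P - ?l w) else 0)" for P
  have b: "b \<notin> set bs" and bs: "distinct bs" "c ` set bs \<subseteq> {1..<n}" and k: "c b \<in> {1..<n}"
    using snoc.prems by auto
  have IH: "(\<Sum>P\<in>Pow (set bs). f v P) = subword_poly (rev (map c bs)) v"
    if "v permutes {1..n}" for v
    unfolding f_def using snoc.IH[OF bs that] .
  have ws: "w \<circ> ?s permutes {1..n}"
    by (rule comp_simple_transp_permutes[OF snoc.prems(3) k])
  have g: "g P + g (insert b P) = (if descent w (c b) then ?X * f w P + f (w \<circ> ?s) P else f w P)"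
    if P: "P \<subseteq> set bs" for P
  proof -
    have letters: "set (map c (filter (\<lambda>b. b \<in> P) bs)) \<subseteq> {1..<n}"
      using bs(2) by auto
    have g1: "g P = f w P"
      using filter_insert_snoc(1)[OF b P] by (simp only: g_def f_def)
    have "card (insert b P) = Suc (card P)"
      using b P by (subst card_insert_disjoint) (auto intro: finite_subset)
    then have g2: "g (insert b P) = (if descent w (c b) \<and> (?dem P = w \<or> ?dem P = w \<circ> ?s)
        then (?X - 1) ^ (Suc (card P) - ?l w) else 0)"
      unfolding g_def filter_insert_snoc(2)[OF b P]
      by (simp only: map_append list.map word_demazure_snoc_eq_iff[OF letters k])
    \<comment> \<open>Keeps the subtraction of natural numbers exact when P has product w.\<close>
    have len: "?l (?dem P) \<le> card P"
      using word_demazure_length[OF letters] length_filter_subset[OF bs(1) P] by simp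
    show ?thesis
    proof (cases "descent w (c b)")
      case False
      then show ?thesis by (simp add: g1 g2)
    next
      case True
      have l: "?l w = Suc (?l (w \<circ> ?s))"
        by (rule coxeter_length_descent[OF snoc.prems(3) k True])
      then have "w \<circ> ?s \<noteq> w" by (metis n_not_Suc_n)
      then consider "?dem P = w" "?dem P \<noteq> w \<circ> ?s" | "?dem P = w \<circ> ?s" "?dem P \<noteq> w"
        | "?dem P \<noteq> w" "?dem P \<noteq> w \<circ> ?s"
        by metis
      then show ?thesis
      proof cases
        case 1
        \<comment> \<open>Both sets of the pair have product w, and their terms add up by t + (X -
          1) t = X t.\<close>
        then have "Suc (card P) - ?l w = Suc (card P - ?l w)" using len by simp
        with 1 True have "g P + g (insert b P) =
            (?X - 1) ^ (card P - ?l w) + (?X - 1) * (?X - 1) ^ (card P - ?l w)"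
          by (simp only: g1 g2 f_def power_Suc simp_thms if_True)
        also have "\<dots> = ?X * (?X - 1) ^ (card P - ?l w)"
          by (simp only: algebra_simps mult_1_left)
        finally show ?thesis using 1 True by (simp only: f_def simp_thms if_True if_False add_0_right)
      next
        case 2
        \<comment> \<open>Only \<open>insert b P\<close> contributes; its additional box is offset
          by l(w) = l(w s_k) + 1.\<close>
        then have "Suc (card P) - ?l w = card P - ?l (w \<circ> ?s)" using l by simp
        with 2 True show ?thesis
          by (simp only: g1 g2 f_def simp_thms if_True if_False mult_zero_right)
      next
        case 3
        with True show ?thesis
          by (simp only: g1 g2 f_def simp_thms if_True if_False mult_zero_right)
      qed
    qed
  qed
  have "(\<Sum>P\<in>Pow (set (bs @ [b])). g P) = (\<Sum>P\<in>Pow (set bs). g P + g (insert b P))"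
    using sum_Pow_insert[of "set bs" b g] b by simp
  also have "\<dots> = (\<Sum>P\<in>Pow (set bs). if descent w (c b) then ?X * f w P + f (w \<circ> ?s) P else f w P)"
    by (rule sum.cong) (use g in auto)
  also have "\<dots> = (if descent w (c b)
      then ?X * (\<Sum>P\<in>Pow (set bs). f w P) + (\<Sum>P\<in>Pow (set bs). f (w \<circ> ?s) P)
      else (\<Sum>P\<in>Pow (set bs). f w P))"
    by (cases "descent w (c b)") (simp_all only: if_True if_False sum.distrib sum_distrib_left)
  also have "\<dots> = subword_poly (rev (map c (bs @ [b]))) w"
    by (simp add: IH[OF snoc.prems(3)] IH[OF ws])
  finally show ?case unfolding g_def .
qed

text \<open>The same pairing. A set without the last box gains a factor X, since the word is one
  longer. At a descent, a set with the last box carries the term of w s_k, again because box count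
  and length both grow by one.\<close>

lemma sum_contains_reduced_eq_subword_poly:
  assumes "distinct bs" "c ` set bs \<subseteq> {1..<n}" "w permutes {1..n}"
  shows "(\<Sum>S\<in>Pow (set bs). if contains_reduced n w (map c (filter (\<lambda>b. b \<in> S) bs))
      then [:0, 1:] ^ (length bs - card S) * [:1, -1:] ^ (card S - coxeter_length n w) else 0) =
    (subword_poly (rev (map c bs)) w :: 'a::comm_ring_1 poly)"
  using assms
proof (induction bs arbitrary: w rule: rev_induct)
  case Nil
  then show ?case by (auto simp: contains_reduced_Nil)
next
  case (snoc b bs)
  let ?l = "coxeter_length n"
  let ?X = "[:0, 1:] :: 'a poly"
  let ?Y = "[:1, -1:] :: 'a poly"
  let ?s = "simple_transp (c b)"
  let ?con = "\<lambda>w S. contains_reduced n w (map c (filter (\<lambda>b. b \<in> S) bs))"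
  define f where
    "f w S = (if ?con w S then ?X ^ (length bs - card S) * ?Y ^ (card S - ?l w) else 0)" for w S
  define g where
    "g S = (if contains_reduced n w (map c (filter (\<lambda>x. x \<in> S) (bs @ [b])))
      then ?X ^ (length (bs @ [b]) - card S) * ?Y ^ (card S - ?l w) else 0)" for S
  have b: "b \<notin> set bs" and bs: "distinct bs" "c ` set bs \<subseteq> {1..<n}" and k: "c b \<in> {1..<n}"
    using snoc.prems by auto
  have IH: "(\<Sum>S\<in>Pow (set bs). f v S) = subword_poly (rev (map c bs)) v"
    if "v permutes {1..n}" for v
    unfolding f_def using snoc.IH[OF bs that] .
  have ws: "w \<circ> ?s permutes {1..n}"
    by (rule comp_simple_transp_permutes[OF snoc.prems(3) k])
  have g: "g S + g (insert b S) = (if descent w (c b) then ?X * f w S + f (w \<circ> ?s) S else f w S)"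
    if S: "S \<subseteq> set bs" for S
  proof -
    have letters: "set (map c (filter (\<lambda>b. b \<in> S) bs)) \<subseteq> {1..<n}"
      using bs(2) by auto
    have card_le: "card S \<le> length bs"
      using card_mono[OF _ S] bs(1) by (simp add: distinct_card)
    then have "length (bs @ [b]) - card S = Suc (length bs - card S)" by simp
    then have g1: "g S = ?X * f w S"
      unfolding g_def f_def filter_insert_snoc(1)[OF b S] by (simp only: power_Suc mult.assoc mult_zero_right split: if_split) simp
    have "card (insert b S) = Suc (card S)"
      using b S by (subst card_insert_disjoint) (auto intro: finite_subset)
    then have g2: "g (insert b S) = (if ?con (if descent w (c b) then w \<circ> ?s else w) S
        then ?X ^ (length bs - card S) * ?Y ^ (Suc (card S) - ?l w) else 0)"
      unfolding g_def filter_insert_snoc(2)[OF b S] map_append list.map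
        contains_reduced_snoc[OF snoc.prems(3) letters k]
      by simp
    show ?thesis
    proof (cases "descent w (c b)")
      case False
      \<comment> \<open>Without a descent the last box is a cone point, and coning preserves the
        h-polynomial: the factors X and 1 - X of the pair sum to 1.\<close>
      have "g (insert b S) = ?Y * f w S"
      proof (cases "?con w S")
        case True
        then have "?l w \<le> card S"
          using contains_reduced_length length_filter_subset[OF bs(1) S] by fastforce
        then have "Suc (card S) - ?l w = Suc (card S - ?l w)" by simp
        then show ?thesis
          using True False by (simp only: g2 f_def if_True if_False power_Suc mult.left_commute)
      next
        case False
        then show ?thesis using \<open>\<not> descent w (c b)\<close> by (simp only: g2 f_def if_False mult_zero_right)
      qed
      then have "g S + g (insert b S) = (?X + ?Y) * f w S"
        by (simp only: g1 distrib_right)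
      also have "?X + ?Y = 1" by simp
      finally show ?thesis using False by simp
    next
      case True
      have "?l w = Suc (?l (w \<circ> ?s))"
        by (rule coxeter_length_descent[OF snoc.prems(3) k True])
      then have "g (insert b S) = f (w \<circ> ?s) S"
        using True by (simp add: g2 f_def)
      then show ?thesis using True by (simp only: g1 if_True)
    qed
  qed
  have "(\<Sum>S\<in>Pow (set (bs @ [b])). g S) = (\<Sum>S\<in>Pow (set bs). g S + g (insert b S))"
    using sum_Pow_insert[of "set bs" b g] b by simp
  also have "\<dots> = (\<Sum>S\<in>Pow (set bs). if descent w (c b) then ?X * f w S + f (w \<circ> ?s) S else f w S)"
    by (rule sum.cong) (use g in auto)
  also have "\<dots> = (if descent w (c b)
      then ?X * (\<Sum>S\<in>Pow (set bs). f w S) + (\<Sum>S\<in>Pow (set bs). f (w \<circ> ?s) S)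
      else (\<Sum>S\<in>Pow (set bs). f w S))"
    by (cases "descent w (c b)") (simp_all only: if_True if_False sum.distrib sum_distrib_left)
  also have "\<dots> = subword_poly (rev (map c (bs @ [b]))) w"
    by (simp add: IH[OF snoc.prems(3)] IH[OF ws])
  finally show ?case unfolding g_def .
qed

section \<open>Substitution\<close>

lemma prod_keys_superset:
  assumes "finite A" "Poly_Mapping.keys m \<subseteq> A"
  shows "(\<Prod>v\<in>Poly_Mapping.keys m. \<phi> v ^ Poly_Mapping.lookup m v) =
    (\<Prod>v\<in>A. \<phi> v ^ Poly_Mapping.lookup m v :: 'r::comm_ring_1)"
  using assms by (intro prod.mono_neutral_left) (auto simp: in_keys_iff)

lemma prod_keys_add:
  "(\<Prod>v\<in>Poly_Mapping.keys (m + m'). \<phi> v ^ Poly_Mapping.lookup (m + m') v) =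
    (\<Prod>v\<in>Poly_Mapping.keys m. \<phi> v ^ Poly_Mapping.lookup m v) *
    (\<Prod>v\<in>Poly_Mapping.keys m'. \<phi> v ^ Poly_Mapping.lookup m' v :: 'r::comm_ring_1)"
proof -
  let ?A = "Poly_Mapping.keys m \<union> Poly_Mapping.keys m'"
  have "Poly_Mapping.keys (m + m') \<subseteq> ?A" by (rule keys_add)
  then show ?thesis
    using prod_keys_superset[of ?A "m + m'" \<phi>] prod_keys_superset[of ?A m \<phi>]
      prod_keys_superset[of ?A m' \<phi>]
    by (simp add: lookup_add power_add prod.distrib)
qed

lemma substitute_0: "substitute \<phi> 0 = 0"
  by (simp add: substitute_def)

lemma substitute_add: "substitute \<phi> (p + q) = substitute \<phi> p + substitute \<phi> q"
  unfolding substitute_def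
  by (rule setsum_keys_plus_distrib) (simp_all add: distrib_right)

lemma substitute_diff: "substitute \<phi> (p - q) = substitute \<phi> p - substitute \<phi> q"
  using substitute_add[of \<phi> "p - q" q] by simp

lemma substitute_sum: "substitute \<phi> (\<Sum>x\<in>A. f x) = (\<Sum>x\<in>A. substitute \<phi> (f x))"
  by (induction A rule: infinite_finite_induct) (simp_all add: substitute_0 substitute_add)

lemma substitute_single:
  "substitute \<phi> (Poly_Mapping.single m c) =
    of_int c * (\<Prod>v\<in>Poly_Mapping.keys m. \<phi> v ^ Poly_Mapping.lookup m v)"
  by (simp add: substitute_def)

lemma substitute_1: "substitute \<phi> 1 = 1"
  using substitute_single[of \<phi> 0 1] by simp

lemma poly_mapping_eq_sum_single:
  "p = (\<Sum>m\<in>Poly_Mapping.keys p. Poly_Mapping.single m (Poly_Mapping.lookup p m))"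
  by (rule poly_mapping_eqI) (simp add: lookup_sum lookup_single when_def in_keys_iff)

text \<open>Expanding both factors into monomials reduces this to
  \<open>prod_keys_add\<close>.\<close>

lemma substitute_mult: "substitute \<phi> (p * q) = substitute \<phi> p * substitute \<phi> q"
proof -
  let ?m = "\<lambda>m. \<Prod>v\<in>Poly_Mapping.keys m. \<phi> v ^ Poly_Mapping.lookup m v"
  let ?P = "Poly_Mapping.keys p" and ?Q = "Poly_Mapping.keys q"
  have "p * q = (\<Sum>m\<in>?P. \<Sum>m'\<in>?Q.
      Poly_Mapping.single (m + m') (Poly_Mapping.lookup p m * Poly_Mapping.lookup q m'))"
    by (subst poly_mapping_eq_sum_single[of p], subst poly_mapping_eq_sum_single[of q])
      (simp only: sum_product mult_single)
  then have "substitute \<phi> (p * q) = (\<Sum>m\<in>?P. \<Sum>m'\<in>?Q.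
      (of_int (Poly_Mapping.lookup p m) * ?m m) * (of_int (Poly_Mapping.lookup q m') * ?m m'))"
    by (simp only: substitute_sum substitute_single prod_keys_add of_int_mult mult_ac)
  also have "\<dots> = substitute \<phi> p * substitute \<phi> q"
    by (simp only: substitute_def sum_product)
  finally show ?thesis .
qed

lemma substitute_power: "substitute \<phi> (p ^ k) = substitute \<phi> p ^ k"
  by (induction k) (simp_all add: substitute_1 substitute_mult)

lemma substitute_prod: "substitute \<phi> (\<Prod>x\<in>A. f x) = (\<Prod>x\<in>A. substitute \<phi> (f x))"
  by (induction A rule: infinite_finite_induct) (simp_all add: substitute_1 substitute_mult)

lemma substitute_Var: "substitute \<phi> (Var v) = \<phi> v"
  unfolding Var_def substitute_single by simp

lemma specialized_grothendieck_eq: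
  "specialized_grothendieck n w =
    (\<Sum>P\<in>Pipes n w. (beta_var - 1) ^ codim (PD n w) (staircase n - P))"
proof -
  have "(\<Prod>x\<in>P. substitute \<phi> (case x of (i, j) \<Rightarrow> Var (X i) - Var (Y j))) = 1"
    if "\<And>i j. \<phi> (X i) - \<phi> (Y j) = 1" for P and \<phi> :: "gvar \<Rightarrow> int poly poly"
    using that by (intro prod.neutral) (auto simp: substitute_diff substitute_Var)
  then show ?thesis
    by (simp add: specialized_grothendieck_def double_grothendieck_def substitute_sum
        substitute_mult substitute_power substitute_prod substitute_Var)
qed

section \<open>The \<open>h\<close>-polynomial as a sum over faces\<close>

lemma smult_sum_right: "smult c (\<Sum>i\<in>A. f i) = (\<Sum>i\<in>A. smult c (f i))"
  by (induction A rule: infinite_finite_induct) (simp_all add: smult_add_right)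

text \<open>Reading off x^(d-i) as the i-th coefficient reverses a polynomial at degree d. Since (x
  - 1)^(d-k) has degree only d - k, its reversal (1 - x)^(d-k) is shifted by x^k.\<close>

lemma reflected_power_sum:
  assumes "k \<le> d"
  shows "(\<Sum>i\<le>d. monom (coeff ([:-1, 1:] ^ (d - k)) (d - i)) i) =
    [:0, 1:] ^ k * ([:1, -1:] :: int poly) ^ (d - k)"
proof (rule poly_eqI)
  fix i
  let ?p = "[:-1, 1:] :: int poly"
  have refl: "reflect_poly ?p = [:1, -1:]" by (simp add: reflect_poly_pCons)
  have deg: "degree (?p ^ (d - k)) = d - k" by (simp add: degree_linear_power degree_power_eq)
  have "([:0, 1:] :: int poly) ^ k * [:1, -1:] ^ (d - k) =
      monom 1 k * reflect_poly (?p ^ (d - k))"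
    by (simp only: reflect_poly_power refl monom_altdef smult_1_left)
  then show "coeff (\<Sum>i\<le>d. monom (coeff (?p ^ (d - k)) (d - i)) i) i =
      coeff ([:0, 1:] ^ k * [:1, -1:] ^ (d - k)) i"
    using assms
    by (auto simp: coeff_sum coeff_monom_mult coeff_reflect_poly deg not_less coeff_eq_0
        if_distrib[of "\<lambda>x. coeff x _"] cong: if_cong)
qed

lemma face_card_le:
  assumes "finite \<Delta>" "F \<in> \<Delta>"
  shows "card F \<le> nat (complex_dim \<Delta> + 1)"
proof -
  have "face_dim F \<le> complex_dim \<Delta>"
    unfolding complex_dim_def using assms by (intro Max_ge) auto
  then show ?thesis by (simp add: face_dim_def)
qed

text \<open>Replaces face numbers by a sum over faces, which complementation can turn into a sum
  over subwords. Dimension k - 1 means k vertices.\<close>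

lemma h_polynomial_eq_sum_faces:
  assumes "finite \<Delta>"
  shows "h_polynomial \<Delta> =
    (\<Sum>F\<in>\<Delta>. [:0, 1:] ^ card F * [:1, -1:] ^ (nat (complex_dim \<Delta> + 1) - card F))"
proof -
  define d where "d = nat (complex_dim \<Delta> + 1)"
  let ?p = "[:-1, 1:] :: int poly"
  let ?r = "\<lambda>k. [:0, 1:] ^ k * ([:1, -1:] :: int poly) ^ (d - k)"
  have "h_polynomial \<Delta> = (\<Sum>i\<le>d. \<Sum>k\<le>d.
      smult (int (f_number \<Delta> (int k - 1))) (monom (coeff (?p ^ (d - k)) (d - i)) i))"
    by (simp add: h_polynomial_def h_number_def Let_def coeff_sum monom_sum smult_monom
        flip: d_def)
  also have "\<dots> = (\<Sum>k\<le>d. smult (int (f_number \<Delta> (int k - 1))) (?r k))"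
    by (subst sum.swap) (simp add: reflected_power_sum flip: smult_sum_right)
  also have "\<dots> = (\<Sum>k\<le>d. \<Sum>F\<in>{F \<in> \<Delta>. card F = k}. ?r (card F))"
    by (intro sum.cong refl) (simp add: f_number_def face_dim_def of_nat_poly)
  also have "\<dots> = (\<Sum>F\<in>\<Delta>. ?r (card F))"
    using assms face_card_le[OF assms] by (intro sum.group) (auto simp: d_def)
  finally show ?thesis unfolding d_def .
qed

section \<open>The pipe dream complex\<close>

abbreviation letter :: "nat \<times> nat \<Rightarrow> nat"
  where "letter \<equiv> \<lambda>(i, j). i + j - 1"

lemma letter_staircase: "letter ` set (boxes n) \<subseteq> {1..<n}"
  unfolding set_boxes by (auto simp: staircase_def)

lemma distinct_boxes: "distinct (boxes n)"
proof -
  let ?row = "\<lambda>i. map (\<lambda>j. (i, j)) (rev [1..<Suc (n - i)])"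
  have "inj_on ?row {1..<n}"
  proof (rule inj_onI)
    fix i i' assume *: "i \<in> {1..<n}" "i' \<in> {1..<n}" "?row i = ?row i'"
    \<comment> \<open>Every row with i < n is nonempty, so its first box identifies it.\<close>
    have "(i, 1) \<in> set (?row i)" using *(1) by auto
    then have "(i, 1) \<in> set (?row i')" using *(3) by (simp only:)
    then show "i = i'" by auto
  qed
  then show ?thesis
    unfolding boxes_def
    by (intro distinct_concat) (auto simp: distinct_map inj_on_def)
qed

lemma letters_boxes: "map letter (boxes n) = concat (map (\<lambda>i. rev [i..<n]) [1..<n])"
proof -
  have "map (\<lambda>j. i + j - 1) [1..<Suc (n - i)] = [i..<n]" for i
    by (rule nth_equalityI) (auto simp del: upt_Suc)
  then show ?thesis
    unfolding boxes_def map_concat map_map comp_def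
    by (simp add: comp_def flip: rev_map)
qed

text \<open>A subword is a choice of positions; as the boxes are distinct, a set of boxes records
  that choice even where letters repeat.\<close>

lemma subseq_map_obtain_subset:
  assumes "subseq ks (map c bs)" "distinct bs"
  obtains S where "S \<subseteq> set bs" "map c (filter (\<lambda>b. b \<in> S) bs) = ks"
proof -
  obtain N where "ks = nths (map c bs) N"
    using assms(1) unfolding subseq_conv_nths by blast
  then have "map c (filter (\<lambda>b. b \<in> set (nths bs N)) bs) = ks"
    using assms(2) by (simp add: nths_map filter_in_nths)
  then show ?thesis using that[OF set_nths_subset] by blast
qed

section \<open>Faces and dimension of the complex\<close>

lemma mem_PD_iff:
  "F \<in> PD n w \<longleftrightarrow>
    F \<subseteq> staircase n \<and> contains_reduced n w (subword n (staircase n - F))"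
  by (simp add: PD_def contains_reduced_def)

lemma finite_staircase: "finite (staircase n)"
  using finite_set[of "boxes n"] by (simp only: set_boxes)

lemma card_staircase: "card (staircase n) = length (boxes n)"
  using distinct_card[OF distinct_boxes, of n] by (simp only: set_boxes)

lemma finite_PD: "finite (PD n w)"
  by (rule finite_subset[of _ "Pow (staircase n)"]) (auto simp: PD_def finite_staircase)

lemma length_subword: "S \<subseteq> staircase n \<Longrightarrow> length (subword n S) = card S"
  unfolding subword_def length_map
  by (rule length_filter_subset) (simp_all add: distinct_boxes set_boxes)

lemma exists_reduced_subword:
  assumes "w permutes {1..n}"
  obtains S where "S \<subseteq> staircase n" "reduced_word n w (subword n S)"
proof (cases "1 \<le> n")
  case True
  then obtain ks where ks: "subseq ks (map letter (boxes n))" "word_product ks = w"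
    using subseq_triangular_word[OF assms] unfolding letters_boxes by blast
  have "set (map letter (boxes n)) \<subseteq> {1..<n}"
    using letter_staircase by (simp only: set_map)
  from contains_reduced_word_product[OF ks(1) this]
  have "contains_reduced n w (map letter (boxes n))" by (simp only: ks(2))
  then obtain rs where rs: "subseq rs (map letter (boxes n))" "reduced_word n w rs"
    unfolding contains_reduced_def by blast
  obtain S where "S \<subseteq> staircase n" "subword n S = rs"
    using subseq_map_obtain_subset[OF rs(1) distinct_boxes] unfolding subword_def set_boxes by blast
  then show ?thesis using that rs(2) by blast
next
  case False
  then have "w = id" using assms by (simp add: not_less_eq_eq)
  then have "reduced_word n w (subword n {})"
    by (simp add: reduced_word_def subword_def)
  then show ?thesis using that by blast
qed

text \<open>The complement of a face contains a reduced word, hence at least l(w) boxes. The set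
  from \<open>exists_reduced_subword\<close> has exactly l(w), so its complement is a face of
  maximal size.\<close>

lemma complex_dim_PD:
  assumes "w permutes {1..n}"
  shows "complex_dim (PD n w) = int (card (staircase n)) - int (coxeter_length n w) - 1"
  unfolding complex_dim_def
proof (rule Max_eqI)
  show "finite (face_dim ` PD n w)" using finite_PD by blast
next
  fix x assume "x \<in> face_dim ` PD n w"
  then obtain F where F: "F \<in> PD n w" "x = face_dim F" by blast
  then have "coxeter_length n w \<le> length (subword n (staircase n - F))"
    by (intro contains_reduced_length) (simp add: mem_PD_iff)
  also have "\<dots> = card (staircase n - F)" by (simp add: length_subword)
  also have "\<dots> = card (staircase n) - card F"
    using F(1) by (intro card_Diff_subset) (auto simp: mem_PD_iff intro: finite_subset finite_staircase)
  finally have "coxeter_length n w \<le> card (staircase n) - card F" .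
  moreover have "card F \<le> card (staircase n)"
    using F(1) by (intro card_mono finite_staircase) (simp add: mem_PD_iff)
  ultimately show "x \<le> int (card (staircase n)) - int (coxeter_length n w) - 1"
    by (simp add: F(2) face_dim_def)
next
  obtain S where S: "S \<subseteq> staircase n" "reduced_word n w (subword n S)"
    by (rule exists_reduced_subword[OF assms])
  let ?F = "staircase n - S"
  have "staircase n - ?F = S" using S(1) by blast
  then have "?F \<in> PD n w"
    using S(2) by (auto simp: mem_PD_iff intro: contains_reducedI)
  moreover have "card S = coxeter_length n w"
    using S length_subword[OF S(1)] by (simp add: reduced_word_def)
  then have "card ?F = card (staircase n) - coxeter_length n w"
    using S(1) by (simp add: card_Diff_subset finite_subset[OF _ finite_staircase])
  moreover have "coxeter_length n w \<le> card (staircase n)"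
    using \<open>card S = _\<close> card_mono[OF finite_staircase S(1)] by simp
  ultimately show "int (card (staircase n)) - int (coxeter_length n w) - 1 \<in> face_dim ` PD n w"
    by (intro image_eqI[of _ _ ?F]) (simp_all add: face_dim_def)
qed

lemma h_polynomial_PD_eq_subword_poly:
  assumes "w permutes {1..n}"
  shows "h_polynomial (PD n w) = subword_poly (rev (map letter (boxes n))) w"
proof -
  let ?D = "staircase n" and ?l = "coxeter_length n w"
  let ?r = "\<lambda>S. [:0, 1:] ^ (length (boxes n) - card S) * ([:1, -1:] :: int poly) ^ (card S - ?l)"
  have d: "nat (complex_dim (PD n w) + 1) = length (boxes n) - ?l"
    by (simp add: complex_dim_PD[OF assms] card_staircase)
  have card_Diff: "card (?D - F) = length (boxes n) - card F \<and> card F \<le> length (boxes n)"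
    if "F \<subseteq> ?D" for F
    using that card_mono[OF finite_staircase that]
    by (simp add: card_Diff_subset finite_subset[OF _ finite_staircase] card_staircase)
  have "h_polynomial (PD n w) = (\<Sum>S\<in>{S \<in> Pow ?D. contains_reduced n w (subword n S)}. ?r S)"
    unfolding h_polynomial_eq_sum_faces[OF finite_PD] d
  \<comment> \<open>With S the complement of F and d = N - l(w), the exponents |F| and d - |F|
    become N - |S| and |S| - l(w).\<close>
  proof (rule sum.reindex_bij_witness[of _ "\<lambda>S. ?D - S" "\<lambda>F. ?D - F"])
    fix F assume "F \<in> PD n w"
    then have "F \<subseteq> ?D" by (simp add: mem_PD_iff)
    from card_Diff[OF this]
    show "?r (?D - F) = [:0, 1:] ^ card F * [:1, -1:] ^ (length (boxes n) - ?l - card F)"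
      by (simp add: add.commute)
  qed (auto simp: mem_PD_iff double_diff)
  also have "\<dots> = (\<Sum>S\<in>Pow ?D. if contains_reduced n w (subword n S) then ?r S else 0)"
    by (rule sum.inter_filter) (simp add: finite_staircase)
  also have "\<dots> = subword_poly (rev (map letter (boxes n))) w"
    using sum_contains_reduced_eq_subword_poly[OF distinct_boxes letter_staircase assms]
    unfolding subword_def set_boxes .
  finally show ?thesis .
qed

lemma specialized_grothendieck_eq_subword_poly:
  assumes "w permutes {1..n}"
  shows "specialized_grothendieck n w = subword_poly (rev (map letter (boxes n))) w"
proof -
  let ?D = "staircase n" and ?l = "coxeter_length n w"
  have dem: "demazure_product n P = word_demazure n (subword n P)" for P
    by (simp only: demazure_product_def word_demazure_def)
  \<comment> \<open>Both sides are cut off at 0, so the equation holds for all subsets of the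
    staircase, not only for pipe dreams.\<close>
  have "codim (PD n w) (?D - P) = card P - ?l" if "P \<subseteq> ?D" for P
    using that card_mono[OF finite_staircase that]
    by (simp add: codim_def complex_dim_PD[OF assms] face_dim_def card_Diff_subset
        finite_subset[OF _ finite_staircase])
  then have "specialized_grothendieck n w =
      (\<Sum>P\<in>{P \<in> Pow ?D. word_demazure n (subword n P) = w}. (beta_var - 1) ^ (card P - ?l))"
    unfolding specialized_grothendieck_eq by (intro sum.cong) (auto simp: Pipes_def dem)
  also have "\<dots> = (\<Sum>P\<in>Pow ?D. if word_demazure n (subword n P) = w
      then (beta_var - 1) ^ (card P - ?l) else 0)"
    by (rule sum.inter_filter) (simp add: finite_staircase)
  also have "\<dots> = subword_poly (rev (map letter (boxes n))) w"
    using sum_demazure_eq_subword_poly[OF distinct_boxes letter_staircase assms]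
    unfolding subword_def set_boxes beta_var_def .
  finally show ?thesis .
qed

theorem theorem2p5:
  fixes n :: nat and w :: "nat \<Rightarrow> nat"
  assumes "1 \<le> n" and "w permutes {1..n}"
  shows "specialized_grothendieck n w = map_poly of_int (h_polynomial (PD n w)) \<and>
    (\<exists>p :: nat poly. specialized_grothendieck n w = map_poly of_nat p)"
proof
  note eq = specialized_grothendieck_eq_subword_poly[OF assms(2)]
  show "specialized_grothendieck n w = map_poly of_int (h_polynomial (PD n w))"
    unfolding eq h_polynomial_PD_eq_subword_poly[OF assms(2)]
    \<comment> \<open>The two sides are the recursion over Z[q] and the image of the recursion over
      Z.\<close>
    by (rule map_poly_subword_poly[symmetric]) simp_all
  show "\<exists>p :: nat poly. specialized_grothendieck n w = map_poly of_nat p"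
    unfolding eq
    \<comment> \<open>The witness is the same recursion, run over the natural numbers.\<close>
    by (intro exI[of _ "subword_poly (rev (map letter (boxes n))) w"]
        map_poly_subword_poly[symmetric]) simp_all
qed

end
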